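(* Let $q$ be a prime power, $m$ a positive integer, and $f:\mathbb{F}_q^m\to\mathbb{F}_q$ a function satisfying the following two conditions: (1) when $1\le\mathrm{wt}(\mathbf{x})\le 2$, $f(\mathbf{x})=0$; (2) when $\mathrm{wt}(\mathbf{x})\ge m-1$, then for any $a\in\mathbb{F}_q^*$, $f(a\mathbf{x})=f(\mathbf{x})\neq 0$. Then the linear code $\mathcal{C}_f$ is minimal.
   Context: $\mathrm{wt}(\mathbf{x})$ is the Hamming weight (number of nonzero coordinates) of $\mathbf{x}\in\mathbb{F}_q^m$, and $\mathbf{x}\cdot\mathbf{y}=\sum_i x_iy_i$. For $f:\mathbb{F}_q^m\to\mathbb{F}_q$, $\mathcal{C}_f=\{(uf(\mathbf{x})+\mathbf{v}\cdot\mathbf{x})_{\mathbf{x}\in\mathbb{F}_q^m\setminus\{\mathbf{0}\}} : u\in\mathbb{F}_q,\ \mathbf{v}\in\mathbb{F}_q^m\}\subseteq\mathbb{F}_q^{q^m-1}$. The support of a vector is the set of its coordinate positions with nonzero entry. A codeword $\mathbf{c}$ of a linear code $\mathcal{C}$ is minimal if every $\mathbf{b}\in\mathcal{C}$ whose support is contained in the support of $\mathbf{c}$ equals $a\mathbf{c}$ for some $a\in\mathbb{F}_q$; the code $\mathcal{C}$ is minimal if all of its codewords are minimal. *)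

theory Defs
  imports "HOL-Analysis.Cartesian_Space"
begin

text \<open>
  The finite field with \<open>q\<close> elements is an arbitrary type \<open>'a::{field,finite}\<close>, with
  \<open>q = CARD('a)\<close>; the space of \<open>m\<close>-tuples over it is \<open>'a ^ 'n\<close>, with \<open>m = CARD('n)\<close>.
  The inner product is \<^const>\<open>scalar_product\<close>; the library's \<open>inner\<close> is for real spaces only.
\<close>

definition supp :: "('a::zero) ^ 'i \<Rightarrow> 'i set"
  where "supp x = {i. x $ i \<noteq> 0}"

definition wt :: "('a::zero) ^ 'i \<Rightarrow> nat"
  where "wt x = card (supp x)"

text \<open>
  The nonzero vectors as a type, so that words indexed by them are again vectors of
  the type \<open>'a ^ ('a, 'n) nonzero_vec\<close>, whose dimension is \<open>q ^ m - 1\<close>.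
\<close>

typedef (overloaded) ('a::zero_neq_one, 'n::finite) nonzero_vec = "{x :: 'a ^ 'n. x \<noteq> 0}"
  morphisms vec_of Nonzero_vec
proof -
  have "(\<chi> i. 1) \<noteq> (0 :: 'a ^ 'n)"
    by (simp add: vec_eq_iff)
  then show ?thesis
    by blast
qed

instance nonzero_vec :: ("{zero_neq_one,finite}", finite) finite
proof
  have "inj (vec_of :: ('a, 'b) nonzero_vec \<Rightarrow> 'a ^ 'b)"
    by (simp add: inj_on_def vec_of_inject)
  then show "finite (UNIV :: ('a, 'b) nonzero_vec set)"
    by (rule finite_imageD[rotated]) simp
qed

lemma card_nonzero_vec:
  "CARD(('a::{zero_neq_one,finite}, 'n::finite) nonzero_vec) = CARD('a) ^ CARD('n) - 1"
proof -
  have "CARD(('a, 'n) nonzero_vec) = card {x :: 'a ^ 'n. x \<noteq> 0}"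
    by (rule type_definition.card[OF type_definition_nonzero_vec])
  also have "{x :: 'a ^ 'n. x \<noteq> 0} = UNIV - {0}"
    by auto
  also have "card \<dots> = CARD('a) ^ CARD('n) - 1"
    by (simp add: card_Diff_singleton)
  finally show ?thesis .
qed

definition code_of ::
    "(('a::{field,finite}) ^ 'n \<Rightarrow> 'a) \<Rightarrow> ('a ^ ('a, 'n) nonzero_vec) set"
  where "code_of f =
    {\<chi> x. u * f (vec_of x) + scalar_product v (vec_of x) | (u :: 'a) (v :: 'a ^ 'n). True}"

definition minimal_codeword :: "(('a::field) ^ 'i) set \<Rightarrow> 'a ^ 'i \<Rightarrow> bool"
  where "minimal_codeword C c \<longleftrightarrow>
    c \<in> C \<and> (\<forall>b\<in>C. supp b \<subseteq> supp c \<longrightarrow> (\<exists>a. b = a *s c))"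

definition minimal_code :: "(('a::field) ^ 'i) set \<Rightarrow> bool"
  where "minimal_code C \<longleftrightarrow> (\<forall>c\<in>C. minimal_codeword C c)"

lemma subspace_code_of: "vec.subspace (code_of f)"
proof (rule vec.subspaceI)
  have "0 = (\<chi> x. 0 * f (vec_of x) + scalar_product 0 (vec_of x))"
    by (simp add: vec_eq_iff scalar_product_def)
  then show "0 \<in> code_of f"
    unfolding code_of_def by blast
next
  fix c d assume "c \<in> code_of f" "d \<in> code_of f"
  then obtain u v u' v' where
      "c = (\<chi> x. u * f (vec_of x) + scalar_product v (vec_of x))"
      "d = (\<chi> x. u' * f (vec_of x) + scalar_product v' (vec_of x))"
    unfolding code_of_def by blast
  then have "c + d = (\<chi> x. (u + u') * f (vec_of x) + scalar_product (v + v') (vec_of x))"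
    by (simp add: vec_eq_iff scalar_product_def algebra_simps sum.distrib)
  then show "c + d \<in> code_of f"
    unfolding code_of_def by blast
next
  fix a c assume "c \<in> code_of f"
  then obtain u v where
      "c = (\<chi> x. u * f (vec_of x) + scalar_product v (vec_of x))"
    unfolding code_of_def by blast
  then have "a *s c = (\<chi> x. (a * u) * f (vec_of x) + scalar_product (a *s v) (vec_of x))"
    by (simp add: vec_eq_iff scalar_product_def algebra_simps sum_distrib_left)
  then show "a *s c \<in> code_of f"
    unfolding code_of_def by blast
qed

end

theory Submission imports Defs begin

text \<open>
  Words of weight at most two see only the linear part of a codeword. Hence, if the support of
  the word of \<open>(u', v')\<close> is contained in that of \<open>(u, v)\<close>, then \<open>v' = k v\<close>, provided \<open>u = 0\<close> or
  \<open>u' = 0\<close>; for \<open>u \<noteq> 0\<close> the case \<open>u' = 0\<close> is reached by subtracting a multiple of the larger word.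
  Evaluation at a point of weight at least \<open>m - 1\<close>, where \<open>f\<close> does not vanish, decides both cases:
  for \<open>u = 0\<close> a point orthogonal to \<open>v\<close> gives \<open>u' = 0\<close>; for \<open>u' = 0\<close>, scaling a point not
  orthogonal to \<open>v\<close> gives a zero of the larger word at which \<open>v \<cdot> x \<noteq> 0\<close>, so \<open>v' = 0\<close>.
\<close>

lemma scalar_product_axis: "scalar_product v (axis i a) = v $ i * (a :: 'a::semiring_1)"
proof -
  have "v $ j * axis i a $ j = (if i = j then v $ j * a else 0)" for j
    by (simp add: axis_def)
  then show ?thesis
    by (simp add: scalar_product_def)
qed

lemma scalar_product_scaleR: "scalar_product v (a *s x) = a * scalar_product v (x :: 'a::comm_semiring_1 ^ 'n)"
  by (simp add: scalar_product_def sum_distrib_left ac_simps)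

lemma scalar_product_scaleL: "scalar_product (a *s v) x = a * scalar_product v (x :: 'a::comm_semiring_1 ^ 'n)"
  by (simp add: scalar_product_def sum_distrib_left ac_simps)

lemma scalar_product_diffR:
  "scalar_product v (x - y) = scalar_product v x - scalar_product v (y :: 'a::ring_1 ^ 'n)"
  by (simp add: scalar_product_def sum_subtractf right_diff_distrib)

lemma scalar_product_diffL:
  "scalar_product (v - w) x = scalar_product v x - scalar_product w (x :: 'a::ring_1 ^ 'n)"
  by (simp add: scalar_product_def sum_subtractf left_diff_distrib)

lemma wt_axis: "a \<noteq> 0 \<Longrightarrow> wt (axis i a :: 'a::zero ^ 'n) = 1"
  by (simp add: wt_def supp_def axis_def)

text \<open>Set every coordinate to 1 except one where \<open>v\<close> is nonzero; solving for that
  coordinate gives any prescribed value \<open>t\<close>, and at most this coordinate can become 0.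
  Used below with \<open>t\<close> = 0 and \<open>t\<close> = 1.\<close>

lemma ex_large_wt_scalar_product:
  fixes v :: "'a::field ^ 'n"
  assumes "v \<noteq> 0"
  shows "\<exists>x. CARD('n) - 1 \<le> wt x \<and> scalar_product v x = t"
proof -
  obtain i where i: "v $ i \<noteq> 0"
    using assms by (auto simp: vec_eq_iff)
  define s where "s = (\<Sum>j\<in>UNIV - {i}. v $ j)"
  define x :: "'a ^ 'n" where "x = (\<chi> j. if j = i then (t - s) / v $ i else 1)"
  have "scalar_product v x = v $ i * x $ i + (\<Sum>j\<in>UNIV - {i}. v $ j * x $ j)"
    unfolding scalar_product_def by (rule sum.remove) simp_all
  also have "(\<Sum>j\<in>UNIV - {i}. v $ j * x $ j) = s"
    unfolding s_def by (rule sum.cong) (simp_all add: x_def)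
  finally have "scalar_product v x = t"
    using i by (simp add: x_def)
  moreover have "card (UNIV - {i}) \<le> wt x"
    unfolding wt_def by (rule card_mono) (auto simp: supp_def x_def)
  ultimately show ?thesis
    by (auto simp: card_Diff_singleton)
qed

text \<open>For \<open>v $ i\<close> \<noteq> 0 the test vectors
  \<open>axis j (v $ i) - axis i (v $ j)\<close> are orthogonal to \<open>v\<close>, and
  orthogonality to \<open>w\<close> says that \<open>w\<close> is proportional to \<open>v\<close>
  with ratio \<open>w $ i / v $ i\<close>. For \<open>v = 0\<close> the unit vectors force
  \<open>w = 0\<close>.\<close>

lemma scalar_multiple_if_small_wt_orthogonal:
  fixes v w :: "'a::field ^ 'n"
  assumes orth: "\<And>x. 1 \<le> wt x \<Longrightarrow> wt x \<le> 2 \<Longrightarrow> scalar_product v x = 0 \<Longrightarrow> scalar_product w x = 0"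
  shows "\<exists>k. w = k *s v"
proof (cases "v = 0")
  case True
  have "w $ i = 0" for i
    using orth[of "axis i 1"] True by (simp add: wt_axis scalar_product_axis)
  then have "w = 0 *s v"
    by (simp add: vec_eq_iff)
  then show ?thesis ..
next
  case False
  then obtain i where i: "v $ i \<noteq> 0"
    by (auto simp: vec_eq_iff)
  have "w $ j = w $ i / v $ i * v $ j" for j
  proof (cases "j = i")
    case False
    define x where "x = axis j (v $ i) - axis i (v $ j)"
    have "supp x \<subseteq> {i, j}"
      by (auto simp: supp_def x_def axis_def split: if_splits)
    then have "wt x \<le> card {i, j}"
      unfolding wt_def by (intro card_mono) auto
    then have le: "wt x \<le> 2"
      using False by simp
    have "j \<in> supp x"
      using False i by (simp add: supp_def x_def axis_def)
    then have "1 \<le> wt x"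
      by (auto simp: wt_def Suc_le_eq card_gt_0_iff)
    moreover have "scalar_product v x = 0"
      by (simp add: x_def scalar_product_diffR scalar_product_axis)
    ultimately have "scalar_product w x = 0"
      using orth le by blast
    then have "w $ j * v $ i = w $ i * v $ j"
      by (simp add: x_def scalar_product_diffR scalar_product_axis)
    then show ?thesis
      using i by (simp add: nonzero_eq_divide_eq)
  qed (use i in simp)
  then have "w = (w $ i / v $ i) *s v"
    unfolding vec_eq_iff vector_smult_component by blast
  then show ?thesis ..
qed

text \<open>Frees the choice of test points from the index type: every nonzero vector is a position
  of the code, and zeros pass from the larger word to the smaller.\<close>

lemma supp_subset_code_wordD:
  fixes f :: "'a::{field,finite} ^ 'n \<Rightarrow> 'a"
  assumes "supp (\<chi> x. u' * f (vec_of x) + scalar_product v' (vec_of x))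
      \<subseteq> supp (\<chi> x. u * f (vec_of x) + scalar_product v (vec_of x))"
    and "x \<noteq> 0" and "u * f x + scalar_product v x = 0"
  shows "u' * f x + scalar_product v' x = 0"
proof -
  have "vec_of (Nonzero_vec x) = x"
    using assms(2) by (simp add: Nonzero_vec_inverse)
  then show ?thesis
    using subsetD[OF assms(1), of "Nonzero_vec x"] assms(3) by (auto simp: supp_def)
qed

theorem theorem5p1:
  fixes f :: "('a::{field,finite}) ^ 'n \<Rightarrow> 'a"
  assumes "\<And>x. 1 \<le> wt x \<Longrightarrow> wt x \<le> 2 \<Longrightarrow> f x = 0"
    and "\<And>x a. wt x \<ge> CARD('n) - 1 \<Longrightarrow> a \<noteq> 0 \<Longrightarrow> f (a *s x) = f x \<and> f x \<noteq> 0"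
  shows "minimal_code (code_of f)"
proof -
  note small = assms(1) and large = assms(2)
  have nz_small: "x \<noteq> 0" if "1 \<le> wt x" for x :: "'a ^ 'n"
    using that by (auto simp: wt_def supp_def)
  \<comment> \<open>The zero vector has weight at least m - 1 only for m = 1, and then the two
    conditions on \<open>f\<close> contradict each other at a unit vector.\<close>
  have nz_large: "x \<noteq> 0" if "CARD('n) - 1 \<le> wt x" for x :: "'a ^ 'n"
  proof
    assume "x = 0"
    then have "CARD('n) - 1 \<le> wt (axis i 1 :: 'a ^ 'n)" for i
      using that by (simp add: wt_def supp_def)
    then show False
      using large[of "axis undefined 1" 1] small[of "axis undefined 1"] by (simp add: wt_axis)
  qed
  let ?w = "\<lambda>u v. (\<chi> x. u * f (vec_of x) + scalar_product v (vec_of x)) :: 'a ^ ('a, 'n) nonzero_vec"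
  have "\<exists>a. ?w u' v' = a *s ?w u v" if sub: "supp (?w u' v') \<subseteq> supp (?w u v)" for u u' v v'
  proof (cases "u = 0")
    case True
    have "\<exists>k. v' = k *s v"
    proof (rule scalar_multiple_if_small_wt_orthogonal)
      fix x assume "1 \<le> wt x" "wt x \<le> 2" "scalar_product v x = 0"
      then show "scalar_product v' x = 0"
        using supp_subset_code_wordD[OF sub nz_small] True small by fastforce
    qed
    then obtain k where k: "v' = k *s v" by blast
    have "?w u' v' = k *s ?w u v"
    proof (cases "v = 0")
      case v0: True
      then have "supp (?w u v) = {}"
        using True by (simp add: supp_def scalar_product_def)
      then have "supp (?w u' v') = {}"
        using sub by blast
      then show ?thesis
        using True v0 by (simp add: supp_def vec_eq_iff scalar_product_def)
    next
      case False
      \<comment> \<open>Here the larger word vanishes, and as \<open>v'\<close> is a multiple of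
        \<open>v\<close>, the smaller one reduces to \<open>u' * f x\<close>.\<close>
      then obtain x where x: "CARD('n) - 1 \<le> wt x" "scalar_product v x = 0"
        using ex_large_wt_scalar_product by blast
      then have "u' * f x = 0"
        using supp_subset_code_wordD[OF sub nz_large] True by (simp add: k scalar_product_scaleL)
      moreover have "f x \<noteq> 0"
        using large[of x 1] x by simp
      ultimately show ?thesis
        using True by (simp add: vec_eq_iff k scalar_product_scaleL)
    qed
    then show ?thesis by blast
  next
    case u: False
    \<comment> \<open>Subtracting \<open>u' / u\<close> times the larger word cancels the
      coefficient of \<open>f\<close>; \<open>w\<close> is the linear part that remains, and it
      vanishes at all nonzero zeros of the larger word.\<close>
    define w where "w = v' - (u' / u) *s v"
    have w0: "scalar_product w x = 0" if "x \<noteq> 0" "u * f x + scalar_product v x = 0" for x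
    proof -
      have "scalar_product v x = - (u * f x)"
        using that(2) by (simp add: eq_neg_iff_add_eq_0 add.commute)
      then show ?thesis
        using u supp_subset_code_wordD[OF sub that]
        by (simp add: w_def scalar_product_diffL scalar_product_scaleL add.commute)
    qed
    have "\<exists>k. w = k *s v"
    proof (rule scalar_multiple_if_small_wt_orthogonal)
      fix x assume "1 \<le> wt x" "wt x \<le> 2" "scalar_product v x = 0"
      then show "scalar_product w x = 0"
        using w0[OF nz_small] small by simp
    qed
    then obtain k where k: "w = k *s v" by blast
    have "w = 0"
    proof (cases "v = 0")
      case False
      then obtain x where x: "CARD('n) - 1 \<le> wt x" "scalar_product v x = 1"
        using ex_large_wt_scalar_product by blast
      \<comment> \<open>By homogeneity of the linear part and invariance of \<open>f\<close> under
        scaling, the larger word at \<open>a *s x\<close> equals \<open>u * f x + a\<close>, so this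
        \<open>a\<close> makes it 0. There \<open>w\<close> takes the value \<open>k * a\<close>,
        hence \<open>k = 0\<close>.\<close>
      define a where "a = - (u * f x)"
      have "f x \<noteq> 0"
        using large[of x 1] x by simp
      then have a: "a \<noteq> 0"
        using u by (simp add: a_def)
      have "scalar_product w (a *s x) = 0"
      proof (rule w0)
        show "a *s x \<noteq> 0"
          using a nz_large[OF x(1)] by simp
        show "u * f (a *s x) + scalar_product v (a *s x) = 0"
          unfolding scalar_product_scaleR x(2) conjunct1[OF large[OF x(1) a]] by (simp add: a_def)
      qed
      then show ?thesis
        using a x(2) by (simp add: k scalar_product_scaleL scalar_product_scaleR)
    qed (simp add: k)
    then have v': "v' = (u' / u) *s v"
      by (simp add: w_def)
    have "?w u' v' = (u' / u) *s ?w u v"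
      unfolding v' vec_eq_iff using u by (simp add: scalar_product_scaleL distrib_left)
    then show ?thesis by blast
  qed
  then show ?thesis
    unfolding minimal_code_def minimal_codeword_def by (auto simp: code_of_def)
qed

end
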